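(* Let $m$ be a non-negative integer, let $\mathbb{F}_q$ be a finite field with $q=p^r$ elements, $p$ prime, and let $z\in\mathbb{F}_q$. Then the number $\tilde{P}_m(z)$ of partitions of $z$ into $m$ parts over $\mathbb{F}_q$ is $$\tilde{P}_m(z)=\frac{1}{q}\binom{q+m-2}{m}+D_m(z),$$ where $$D_m(z)=\begin{cases} 0, & \text{if } m\not\equiv 0 \pmod p \text{ and } m\not\equiv 1 \pmod p;\\ \frac{q-1}{q}\binom{q/p-1+j}{j}, & \text{if } m=jp,\ j\ge 0, \text{ and } z=0;\\ -\frac{q-1}{q}\binom{q/p-1+j}{j}, & \text{if } m=jp+1,\ j\ge 0, \text{ and } z=0;\\ -\frac{1}{q}\binom{q/p-1+j}{j}, & \text{if } m=jp,\ j\ge 0, \text{ and } z\in\mathbb{F}_q^*;\\ \frac{1}{q}\binom{q/p-1+j}{j}, & \text{if } m=jp+1,\ j\ge 0, \text{ and } z\in\mathbb{F}_q^*. \end{cases}$$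
   Context: A partition of $z\in\mathbb{F}_q$ into $m$ parts is a multiset of $m$ elements of $\mathbb{F}_q^*=\mathbb{F}_q\setminus\{0\}$ (repetitions allowed, order irrelevant) whose sum is $z$; $\tilde{P}_m(z)$ denotes the number of such multisets. For $m=0$ the only multiset is the empty one, with sum $0$, so $\tilde{P}_0(0)=1$ and $\tilde{P}_0(z)=0$ for $z\neq 0$. *)

theory Defs
  imports
    Complex_Main
    "HOL-Library.Multiset"
    "HOL-Library.Cardinality"
    "HOL-Computational_Algebra.Primes"
    "HOL-Number_Theory.Cong"
begin

definition partitions_into :: "nat \<Rightarrow> 'a::field \<Rightarrow> 'a multiset set" where
  "partitions_into m z = {M. size M = m \<and> 0 \<notin># M \<and> sum_mset M = z}"

definition num_partitions :: "nat \<Rightarrow> 'a::field \<Rightarrow> nat" where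
  "num_partitions m z = card (partitions_into m z)"

text \<open>For prime \<open>p\<close>, the \<open>j\<close> with \<open>m = j * p\<close> or \<open>m = j * p + 1\<close> is necessarily
  \<open>m div p\<close>; the last branch is then the case \<open>m = j * p + 1\<close>, \<open>z \<noteq> 0\<close>
  (see \<open>partition_correction_cases\<close>). In the intended use \<open>p\<close> divides \<open>q\<close>, so \<open>q div p\<close> is exact.\<close>

definition partition_correction :: "nat \<Rightarrow> nat \<Rightarrow> nat \<Rightarrow> 'a::field \<Rightarrow> real" where
  "partition_correction q p m z =
    (let j = m div p; B = real ((q div p - 1 + j) choose j) in
       if \<not> [m = 0] (mod p) \<and> \<not> [m = 1] (mod p) then 0
       else if m = j * p \<and> z = 0 then (real q - 1) / real q * B
       else if m = j * p + 1 \<and> z = 0 then - ((real q - 1) / real q) * B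
       else if m = j * p \<and> z \<noteq> 0 then - (1 / real q) * B
       else 1 / real q * B)"

lemma partition_correction_cases:
  fixes z :: "'a::field"
  assumes "prime p"
  shows "\<not> [m = 0] (mod p) \<Longrightarrow> \<not> [m = 1] (mod p) \<Longrightarrow> partition_correction q p m z = 0"
    and "m = j * p \<Longrightarrow> z = 0 \<Longrightarrow>
      partition_correction q p m z = (real q - 1) / real q * real ((q div p - 1 + j) choose j)"
    and "m = j * p + 1 \<Longrightarrow> z = 0 \<Longrightarrow>
      partition_correction q p m z = - ((real q - 1) / real q) * real ((q div p - 1 + j) choose j)"
    and "m = j * p \<Longrightarrow> z \<noteq> 0 \<Longrightarrow>
      partition_correction q p m z = - (1 / real q) * real ((q div p - 1 + j) choose j)"
    and "m = j * p + 1 \<Longrightarrow> z \<noteq> 0 \<Longrightarrow>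
      partition_correction q p m z = 1 / real q * real ((q div p - 1 + j) choose j)"
proof -
  have p: "p > 1" using assms by (rule prime_gt_1_nat)
  then have d: "Suc (j * p) div p = j" using div_mult_self3[of p j 1] by simp
  have c: "[j * p = 0] (mod p)" "[Suc (j * p) = Suc 0] (mod p)"
    using p by (simp_all add: cong_def mod_Suc)
  show "\<not> [m = 0] (mod p) \<Longrightarrow> \<not> [m = 1] (mod p) \<Longrightarrow> partition_correction q p m z = 0"
    by (simp add: partition_correction_def)
  show "m = j * p \<Longrightarrow> z = 0 \<Longrightarrow>
      partition_correction q p m z = (real q - 1) / real q * real ((q div p - 1 + j) choose j)"
    "m = j * p + 1 \<Longrightarrow> z = 0 \<Longrightarrow>
      partition_correction q p m z = - ((real q - 1) / real q) * real ((q div p - 1 + j) choose j)"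
    "m = j * p \<Longrightarrow> z \<noteq> 0 \<Longrightarrow>
      partition_correction q p m z = - (1 / real q) * real ((q div p - 1 + j) choose j)"
    "m = j * p + 1 \<Longrightarrow> z \<noteq> 0 \<Longrightarrow>
      partition_correction q p m z = 1 / real q * real ((q div p - 1 + j) choose j)"
    using p d c by (simp_all add: partition_correction_def Let_def)
qed

end

theory Submission
  imports Defs "HOL-Number_Theory.Residues"
begin

text \<open>
  Let \<open>N\<^sub>m(z)\<close> be the number of multisets of size \<open>m\<close> and sum \<open>z\<close> that may contain \<open>0\<close>. Counting the
  triples \<open>(M, k, x)\<close> with \<open>1 \<le> k \<le> count M x\<close> in two ways gives the Newton-type recursion
  \<open>m N\<^sub>m(z) = (\<Sum>k=1..m. \<Sum>x. N\<^sub>m\<^sub>-\<^sub>k(z - k x))\<close>. If \<open>p\<close> does not divide \<open>k\<close>, then \<open>x \<mapsto> z - k x\<close> is a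
  bijection and the inner sum is the number of all multisets of size \<open>m - k\<close>; otherwise it is
  \<open>q N\<^sub>m\<^sub>-\<^sub>k(z)\<close>. The coefficients \<open>h\<^sub>m\<close> of \<open>(1 - t)\<^sup>-\<^sup>q\<close> and \<open>e\<^sub>m\<close> of \<open>(1 - t\<^sup>p)\<^sup>-\<^sup>q\<^sup>/\<^sup>p\<close> satisfy the matching
  recursions, so induction on \<open>m\<close> yields \<open>q N\<^sub>m(z) = h\<^sub>m + (q [z = 0] - 1) e\<^sub>m\<close>. Removing one
  zero shows that the number of partitions is \<open>N\<^sub>m(z) - N\<^sub>m\<^sub>-\<^sub>1(z)\<close>.
\<close>

section \<open>Multisets of prescribed size and sum\<close>

definition multisets_with_sum :: "nat \<Rightarrow> 'a::comm_monoid_add \<Rightarrow> 'a multiset set" where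
  "multisets_with_sum m z = {M. size M = m \<and> sum_mset M = z}"

lemma finite_multisets_with_sum [simp]:
  "finite (multisets_with_sum m (z :: 'a::{comm_monoid_add,finite}))"
proof (rule finite_subset)
  show "multisets_with_sum m z \<subseteq> multisets_of_size UNIV m"
    by (auto simp: multisets_with_sum_def multisets_of_size_def)
qed auto

text \<open>Deleting \<open>k\<close> copies of \<open>x\<close> is inverse to adding them and
  lowers the sum by \<open>of_nat k * x\<close>.\<close>

lemma card_multisets_with_sum_count_ge:
  fixes z :: "'a::comm_ring_1"
  assumes "k \<le> m"
  shows "card {M \<in> multisets_with_sum m z. k \<le> count M x}
       = card (multisets_with_sum (m - k) (z - of_nat k * x))"
proof (rule bij_betw_same_card[OF bij_betw_byWitness[where f' = "\<lambda>M. M + replicate_mset k x"]])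
  let ?f = "\<lambda>M. M - replicate_mset k x"
  show "\<forall>M\<in>{M \<in> multisets_with_sum m z. k \<le> count M x}. ?f M + replicate_mset k x = M"
    by (auto simp: count_le_replicate_mset_subset_eq)
  show "\<forall>M\<in>multisets_with_sum (m - k) (z - of_nat k * x). ?f (M + replicate_mset k x) = M"
    by simp
  show "?f ` {M \<in> multisets_with_sum m z. k \<le> count M x}
      \<subseteq> multisets_with_sum (m - k) (z - of_nat k * x)"
  proof (clarsimp simp: multisets_with_sum_def count_le_replicate_mset_subset_eq size_Diff_submset)
    fix M :: "'a multiset"
    assume "replicate_mset k x \<subseteq># M"
    then obtain M' where "M = replicate_mset k x + M'"
      by (auto simp: mset_subset_eq_exists_conv)
    then show "sum_mset (M - replicate_mset k x) = sum_mset M - of_nat k * x"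
      by simp
  qed
  show "(\<lambda>M. M + replicate_mset k x) ` multisets_with_sum (m - k) (z - of_nat k * x)
      \<subseteq> {M \<in> multisets_with_sum m z. k \<le> count M x}"
    using assms by (auto simp: multisets_with_sum_def)
qed

lemma card_multisets_with_sum_recursion:
  fixes z :: "'a::{comm_ring_1,finite}"
  shows "m * card (multisets_with_sum m z)
       = (\<Sum>k=1..m. \<Sum>x\<in>UNIV. card (multisets_with_sum (m - k) (z - of_nat k * x)))"
proof -
  let ?A = "multisets_with_sum m z"
  have size: "(\<Sum>x\<in>UNIV. \<Sum>k=1..m. if k \<le> count M x then 1 else 0) = m" if "M \<in> ?A" for M
  proof -
    have m: "size M = m"
      using that by (simp add: multisets_with_sum_def)
    have "(\<Sum>k=1..m. if k \<le> count M x then 1 else 0) = count M x" for x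
    proof -
      \<comment> \<open>Bounding \<open>k\<close> by \<open>m\<close> loses nothing, since no
        multiplicity exceeds the size \<open>m\<close>.\<close>
      have "{1..m} \<inter> {k. k \<le> count M x} = {1..count M x}"
        using count_le_size[of M x] m by auto
      then show ?thesis
        by (simp add: sum.If_cases)
    qed
    moreover have "(\<Sum>x\<in>UNIV. count M x) = (\<Sum>x\<in>set_mset M. count M x)"
      by (rule sum.mono_neutral_right) (auto simp: not_in_iff)
    ultimately show ?thesis
      using m by (simp add: size_multiset_overloaded_eq)
  qed
  have "m * card ?A = (\<Sum>M\<in>?A. \<Sum>x\<in>UNIV. \<Sum>k=1..m. if k \<le> count M x then 1 else 0)"
    using sum.cong[OF refl size, of ?A] by simp
  also have "\<dots> = (\<Sum>x\<in>UNIV. \<Sum>M\<in>?A. \<Sum>k=1..m. if k \<le> count M x then 1 else 0)"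
    by (rule sum.swap)
  also have "\<dots> = (\<Sum>x\<in>UNIV. \<Sum>k=1..m. \<Sum>M\<in>?A. if k \<le> count M x then 1 else 0)"
    by (intro sum.cong refl sum.swap)
  also have "\<dots> = (\<Sum>k=1..m. \<Sum>x\<in>UNIV. \<Sum>M\<in>?A. if k \<le> count M x then 1 else 0)"
    by (rule sum.swap)
  also have "\<dots> = (\<Sum>k=1..m. \<Sum>x\<in>UNIV. card {M \<in> ?A. k \<le> count M x})"
    by (simp add: sum.If_cases Int_def)
  also have "\<dots> = (\<Sum>k=1..m. \<Sum>x\<in>UNIV. card (multisets_with_sum (m - k) (z - of_nat k * x)))"
    by (intro sum.cong refl card_multisets_with_sum_count_ge) auto
  finally show ?thesis .
qed

section \<open>Recursions for power series coefficients\<close>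

text \<open>For F = (1 - t)^(-n) this compares coefficients in t F' = n t/(1 - t) F. The proof
  combines the hockey-stick sum with absorption; \<open>n > 0\<close> keeps \<open>n - 1\<close>
  from truncating.\<close>

lemma multichoose_recursion:
  assumes "n > 0"
  shows "m * ((n - 1 + m) choose m) = n * (\<Sum>k=1..m. (n - 1 + (m - k)) choose (m - k))"
proof (cases m)
  case (Suc l)
  obtain r where n: "n = Suc r"
    using assms gr0_implies_Suc by blast
  have "(\<Sum>k=1..m. (r + (m - k)) choose (m - k)) = (\<Sum>i\<le>l. (r + i) choose i)"
    by (rule sum.reindex_bij_witness[of _ "\<lambda>i. m - i" "\<lambda>k. m - k"]) (auto simp: Suc)
  also have "\<dots> = Suc (r + l) choose l"
    by (rule sum_choose_lower)
  finally show ?thesis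
    using Suc_times_binomial_add[of l r] by (simp add: n Suc add.commute)
qed simp

text \<open>The coefficient of \<open>t\<^sup>m\<close> in \<open>(1 - t\<^sup>p)\<^sup>-\<^sup>n\<close>.\<close>

definition sparse_multichoose :: "nat \<Rightarrow> nat \<Rightarrow> nat \<Rightarrow> nat" where
  "sparse_multichoose p n m = (if p dvd m then (n - 1 + m div p) choose (m div p) else 0)"

text \<open>This is the previous recursion with t^p in place of t: only multiples of
  \<open>p\<close> contribute, and \<open>m = p * j\<close> supplies the extra factor
  \<open>p\<close>.\<close>

lemma sparse_multichoose_recursion:
  assumes "n > 0" "p > 0"
  shows "m * sparse_multichoose p n m
       = p * n * (\<Sum>k | k \<in> {1..m} \<and> p dvd k. sparse_multichoose p n (m - k))"
proof (cases "p dvd m")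
  case False
  then have "\<not> p dvd m - k" if "k \<le> m" "p dvd k" for k
    using that dvd_diffD by blast
  then show ?thesis
    using False by (auto simp: sparse_multichoose_def)
next
  case True
  then obtain j where m: "m = p * j" ..
  have multiples: "{k. k \<in> {1..m} \<and> p dvd k} = (*) p ` {1..j}"
    using \<open>p > 0\<close> by (auto simp: m Suc_le_eq elim!: dvdE)
  have "inj_on ((*) p) {1..j}"
    using \<open>p > 0\<close> by (simp add: inj_on_def)
  then have "(\<Sum>k | k \<in> {1..m} \<and> p dvd k. sparse_multichoose p n (m - k))
      = (\<Sum>i=1..j. (n - 1 + (j - i)) choose (j - i))"
    unfolding multiples using \<open>p > 0\<close>
    by (simp add: sum.reindex m sparse_multichoose_def flip: diff_mult_distrib2)
  then show ?thesis
    using multichoose_recursion[OF \<open>n > 0\<close>, of j] \<open>p > 0\<close>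
    by (simp add: sparse_multichoose_def m)
qed

section \<open>Closed formula when zero is allowed\<close>

lemma sum_affine_reindex:
  fixes z c :: "'a::{field,finite}" and f :: "'a \<Rightarrow> 'b::comm_monoid_add"
  assumes "c \<noteq> 0"
  shows "(\<Sum>x\<in>UNIV. f (z - c * x)) = (\<Sum>y\<in>UNIV. f y)"
  using assms by (intro sum.reindex_bij_witness[of _ "\<lambda>y. (z - y) / c" "\<lambda>x. z - c * x"]) auto

text \<open>The sparse recursion has the factor \<open>CHAR('a) * n\<close>, which is the factor
  \<open>q\<close> of the dense one, so both sides obey the same recursion in
  \<open>m\<close>.\<close>

lemma card_multisets_with_sum:
  fixes z :: "'a::{field,finite}"
  assumes q: "CARD('a) = q" "q = CHAR('a) * n"
  shows "real q * real (card (multisets_with_sum m z))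
       = real ((q - 1 + m) choose m)
         + (real q * of_bool (z = 0) - 1) * real (sparse_multichoose CHAR('a) n m)"
proof (induction m arbitrary: z rule: less_induct)
  case (less m z)
  let ?p = "CHAR('a)"
  let ?N = "\<lambda>m z. real (card (multisets_with_sum m (z :: 'a)))"
  let ?h = "\<lambda>m. real ((q - 1 + m) choose m)"
  let ?e = "\<lambda>m. real (sparse_multichoose ?p n m)"
  let ?c = "\<lambda>z :: 'a. real q * of_bool (z = 0) - 1"
  have "q > 0"
    using q(1) by (metis zero_less_card_finite)
  then have pos: "n > 0" "?p > 0"
    using q(2) by (auto intro: Nat.gr0I)
  show ?case
  proof (cases "m = 0")
    case True
    have "multisets_with_sum 0 z = (if z = 0 then {{#}} else {})"
      by (auto simp: multisets_with_sum_def)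
    then show ?thesis
      using True by (auto simp: sparse_multichoose_def)
  next
    case False
    \<comment> \<open>The weights \<open>?c y\<close> cancel in the sum over \<open>y\<close>:
      \<open>q - 1\<close> at zero against -1 at each of the \<open>q - 1\<close> other
      elements.\<close>
    have total: "(\<Sum>y\<in>UNIV. ?N l y) = ?h l" if "l < m" for l
    proof -
      have "(\<Sum>y\<in>UNIV. ?c y) = 0"
        by (simp add: sum_subtractf q(1) of_bool_def flip: sum_distrib_left)
      then have "real q * (\<Sum>y\<in>UNIV. ?N l y) = real q * ?h l"
        using that by (simp add: sum_distrib_left less.IH sum.distrib q(1) flip: sum_distrib_right)
      then show ?thesis
        using \<open>q > 0\<close> by simp
    qed
    have inner: "(\<Sum>x\<in>UNIV. ?N (m - k) (z - of_nat k * x))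
        = ?h (m - k) + (if ?p dvd k then ?c z * ?e (m - k) else 0)" if "k \<in> {1..m}" for k
    proof (cases "?p dvd k")
      case True
      then have "of_nat k = (0 :: 'a)"
        by (simp add: of_nat_eq_0_iff_char_dvd)
      then show ?thesis
        using True that less.IH[of "m - k" z] by (simp add: q(1))
    next
      case False
      then have "of_nat k \<noteq> (0 :: 'a)"
        by (simp add: of_nat_eq_0_iff_char_dvd)
      from sum_affine_reindex[OF this, of "?N (m - k)" z] show ?thesis
        using False that total[of "m - k"] by simp
    qed
    have h: "real m * ?h m = real q * (\<Sum>k=1..m. ?h (m - k))"
      using multichoose_recursion[OF \<open>q > 0\<close>, of m]
      by (simp flip: of_nat_mult of_nat_sum)
    have e: "real m * ?e m = real q * (\<Sum>k | k \<in> {1..m} \<and> ?p dvd k. ?e (m - k))"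
      using sparse_multichoose_recursion[OF pos, of m] q(2)
      by (simp flip: of_nat_mult of_nat_sum)
    have "real m * ?N m z = (\<Sum>k=1..m. \<Sum>x\<in>UNIV. ?N (m - k) (z - of_nat k * x))"
      using card_multisets_with_sum_recursion[of m z] by (simp flip: of_nat_mult of_nat_sum)
    also have "\<dots> = (\<Sum>k=1..m. ?h (m - k) + (if ?p dvd k then ?c z * ?e (m - k) else 0))"
      by (intro sum.cong refl inner)
    also have "\<dots> = (\<Sum>k=1..m. ?h (m - k))
        + ?c z * (\<Sum>k | k \<in> {1..m} \<and> ?p dvd k. ?e (m - k))"
      by (simp add: sum.distrib sum_distrib_left flip: sum.inter_filter)
    finally have N: "real m * ?N m z = (\<Sum>k=1..m. ?h (m - k))
        + ?c z * (\<Sum>k | k \<in> {1..m} \<and> ?p dvd k. ?e (m - k))" .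
    have "real m * (real q * ?N m z) = real q * (real m * ?N m z)"
      by simp
    also have "\<dots> = real m * ?h m + ?c z * (real m * ?e m)"
      unfolding N h e by (simp only: distrib_left mult.left_commute)
    also have "\<dots> = real m * (?h m + ?c z * ?e m)"
      by (simp add: algebra_simps)
    finally show ?thesis
      using False by simp
  qed
qed

section \<open>From multisets to partitions\<close>

lemma num_partitions_0: "num_partitions 0 z = of_bool (z = 0)"
proof -
  have "partitions_into 0 z = (if z = 0 then {{#}} else {})"
    by (auto simp: partitions_into_def)
  then show ?thesis
    by (simp add: num_partitions_def)
qed

text \<open>Multisets containing 0 are the case \<open>k = 1\<close>, \<open>x = 0\<close> of the
  deletion bijection, which preserves the sum.\<close>

lemma num_partitions_Suc:
  fixes z :: "'a::{field,finite}"
  shows "num_partitions (Suc m) z + card (multisets_with_sum m z)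
       = card (multisets_with_sum (Suc m) z)"
proof -
  let ?B = "{M \<in> multisets_with_sum (Suc m) z. 1 \<le> count M 0}"
  have "multisets_with_sum (Suc m) z = partitions_into (Suc m) z \<union> ?B"
    "partitions_into (Suc m) z \<inter> ?B = {}"
    by (auto simp: partitions_into_def multisets_with_sum_def Suc_le_eq)
  moreover from this have "finite (partitions_into (Suc m) z)" "finite ?B"
    using finite_multisets_with_sum[of "Suc m" z] by (metis finite_Un)+
  ultimately have "card (multisets_with_sum (Suc m) z) = num_partitions (Suc m) z + card ?B"
    by (metis card_Un_disjoint num_partitions_def)
  then show ?thesis
    using card_multisets_with_sum_count_ge[of 1 "Suc m" z 0] by simp
qed

text \<open>The characteristic of a finite field is a prime dividing its cardinality.\<close>

lemma CHAR_eq_if_CARD_prime_power: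
  assumes "prime p" "CARD('a::{field,finite}) = p ^ r"
  shows "CHAR('a) = p"
proof -
  have "prime CHAR('a)"
    by (intro prime_CHAR_semidom finite_imp_CHAR_pos) simp
  moreover have "CHAR('a) dvd p ^ r"
    using CHAR_dvd_CARD[where 'a = 'a] assms(2) by simp
  ultimately show ?thesis
    using assms(1) by (metis prime_dvd_power primes_dvd_imp_eq)
qed

theorem theorem1:
  fixes m q p r :: nat and z :: "'a::{field,finite}"
  assumes "prime p" and "q = p ^ r" and "CARD('a) = q"
  shows "real (num_partitions m z) =
    1 / real q * real ((q + m - 2) choose m) + partition_correction q p m z"
proof -
  have char: "CHAR('a) = p"
    using assms by (intro CHAR_eq_if_CARD_prime_power) auto
  define n where "n = q div p"
  have "p dvd q"
    using CHAR_dvd_CARD[where 'a = 'a] assms(3) char by simp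
  then have q: "q = CHAR('a) * n"
    by (simp add: n_def char)
  have "q > 0" "p > 1"
    using assms prime_gt_1_nat[of p] by simp_all
  have "q \<ge> p"
    using \<open>p dvd q\<close> \<open>q > 0\<close> by (rule dvd_imp_le)
  \<comment> \<open>This makes the subtraction in \<open>q + m - 2\<close> exact, even for
    \<open>m = 0\<close>.\<close>
  then obtain s where s: "q = Suc (Suc s)"
    using \<open>p > 1\<close> by (intro that[of "q - 2"]) simp
  let ?e = "sparse_multichoose p n"
  define c where "c = real q * of_bool (z = 0) - 1"
  have N: "real q * real (card (multisets_with_sum m z)) = real ((q - 1 + m) choose m) + c * ?e m"
    for m
    using card_multisets_with_sum[OF assms(3) q] by (simp add: c_def char)
  \<comment> \<open>\<open>d\<close> is the coefficient of t^m in (1 - t)(1 - t^p)^(-n); at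
    \<open>m = 0\<close> only \<open>?e 0 = 1\<close> remains.\<close>
  define d where "d = (case m of 0 \<Rightarrow> 1 | Suc l \<Rightarrow> real (?e m) - real (?e l))"
  have count: "real q * real (num_partitions m z) = real ((q + m - 2) choose m) + c * d"
  proof (cases m)
    case 0
    then show ?thesis
      by (simp add: num_partitions_0 c_def d_def)
  next
    case (Suc l)
    have "real (card (multisets_with_sum m z))
        = real (num_partitions m z) + real (card (multisets_with_sum l z))"
      using num_partitions_Suc[of l z] by (simp add: Suc flip: of_nat_add)
    then have "real q * real (num_partitions m z)
        = real q * real (card (multisets_with_sum m z)) - real q * real (card (multisets_with_sum l z))"
      by (simp add: algebra_simps)
    \<comment> \<open>Pascal's rule turns the difference of the two dense terms into the main
      term.\<close>
    also have "\<dots> = real ((q + m - 2) choose m) + c * d"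
      unfolding N by (simp add: Suc s d_def algebra_simps)
    finally show ?thesis .
  qed
  \<comment> \<open>Since \<open>p > 1\<close>, at most one of \<open>m\<close> and
    \<open>m - 1\<close> is a multiple of \<open>p\<close>, so at most one term of \<open>d\<close>
    survives: the sign comes from \<open>d\<close>, the dependence on \<open>z\<close> from
    \<open>c\<close>.\<close>
  have corr: "partition_correction q p m z = c * d / real q"
  proof -
    consider (none) "\<not> [m = 0] (mod p)" "\<not> [m = 1] (mod p)"
      | (zero) j where "m = j * p" | (one) j where "m = j * p + 1"
    proof -
      have "m = m div p * p" if "[m = 0] (mod p)"
        using that by (simp add: cong_0_iff)
      moreover have "m = m div p * p + 1" if "[m = 1] (mod p)"
        using that \<open>p > 1\<close> div_mult_mod_eq[of m p] by (simp add: cong_def)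
      ultimately show ?thesis
        using that by blast
    qed
    then show ?thesis
    proof cases
      case none
      then have "\<not> p dvd m"
        by (simp add: cong_0_iff)
      moreover have "\<not> p dvd l" if "m = Suc l" for l
        using none(2) that cong_add_rcancel_0_nat[of l 1 p] by (simp add: cong_0_iff)
      ultimately have "d = 0"
        by (cases m) (auto simp: d_def sparse_multichoose_def)
      then show ?thesis
        using partition_correction_cases(1)[OF assms(1) none] by simp
    next
      case (zero j)
      have "d = (n - 1 + j) choose j"
      proof (cases m)
        case 0
        then show ?thesis
          using zero \<open>p > 1\<close> by (simp add: d_def)
      next
        case (Suc l)
        have "p dvd Suc l"
          using zero Suc by (metis dvd_triv_right)
        then have "\<not> p dvd l"
          using \<open>p > 1\<close> dvd_add_right_iff[of p l 1] by auto
        then have "d = real (?e m)"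
          by (simp add: Suc d_def sparse_multichoose_def)
        then show ?thesis
          using zero \<open>p > 1\<close> by (simp add: sparse_multichoose_def)
      qed
      then show ?thesis
        using partition_correction_cases(2,4)[OF assms(1) zero, of z q] \<open>q > 0\<close>
        by (cases "z = 0") (simp_all add: c_def n_def field_simps)
    next
      case (one j)
      have "\<not> p dvd Suc (j * p)"
        using \<open>p > 1\<close> dvd_add_right_iff[of p "j * p" 1] by auto
      then have "d = - real ((n - 1 + j) choose j)"
        using one \<open>p > 1\<close> by (simp add: d_def sparse_multichoose_def)
      then show ?thesis
        using partition_correction_cases(3,5)[OF assms(1) one, of z q] \<open>q > 0\<close>
        by (cases "z = 0") (simp_all add: c_def n_def field_simps)
    qed
  qed
  show ?thesis
    using count \<open>q > 0\<close> by (simp add: corr field_simps)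
qed

end
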